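(* For all $l,m\in\{1,\dots,N\}$ the $(l,m)$-entry of the matrix $K=\sum_{j=1}^{N-1}\frac{v_jv_j^*}{\mu_j}\in\mathbb{C}^{N\times N}$ satisfies $$K_{l,m}=\frac1{2N}\biggl[(l-m)^2-N|l-m|+\frac{N^2-1}{6}\biggr].$$
   Context: $N\ge3$ is an integer, $\omega=e^{2\pi\mathrm{i}/N}$, and for $j\in\{1,\dots,N-1\}$, $v_j=\frac1{\sqrt N}(1,\omega^j,\omega^{2j},\dots,\omega^{(N-1)j})^\top\in\mathbb{C}^N$ and $\mu_j=2-2\cos\bigl(\frac{2\pi j}{N}\bigr)$. $^*$ denotes conjugate transpose. *)

theory Defs
  imports Complex_Main "Jordan_Normal_Form.Matrix" "Jordan_Normal_Form.Schur_Decomposition"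
begin

definition root_omega :: "nat \<Rightarrow> complex" where
  "root_omega N = exp (2 * complex_of_real pi * \<i> / of_nat N)"

definition fourier_vec :: "nat \<Rightarrow> nat \<Rightarrow> complex vec" where
  "fourier_vec N j =
     complex_of_real (1 / sqrt (real N)) \<cdot>\<^sub>v vec N (\<lambda>i. root_omega N ^ (i * j))"

definition mu :: "nat \<Rightarrow> nat \<Rightarrow> real" where
  "mu N j = 2 - 2 * cos (2 * pi * real j / real N)"

text \<open>The product \<open>v v\<^sup>*\<close>, with \<open>v\<close> read as a column, i.e. as a matrix with a single column.\<close>

definition mult_adjoint :: "complex vec \<Rightarrow> complex mat" where
  "mult_adjoint v =
     (let A = mat_of_cols (dim_vec v) [v] in A * mat_adjoint A)"

text \<open>Matrices with a dimension given by a term have no type-class zero, so the sum is the one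
  of the module of \<open>N \<times> N\<close> matrices.\<close>

definition K_mat :: "nat \<Rightarrow> complex mat" where
  "K_mat N = finsum (module_mat TYPE(complex) N N)
     (\<lambda>j. complex_of_real (1 / mu N j) \<cdot>\<^sub>m mult_adjoint (fourier_vec N j)) {1..N - 1}"

end

(*
  Up to the factor 1/N the entry is g(l - m), where g(d) is the sum of w^d / mu_j over the roots of
  unity w = omega^j, 0 < j < N. Since mu_j w = -(w - 1)^2, the second difference of g is minus a sum
  of nontrivial roots of unity, hence 1 for 0 < d < N, which is also the second difference of
  p(d) = (d^2 - N d + (N^2 - 1)/6) / 2. So g - p is affine on {0..N}; it takes the same value
  at 0 and N, hence is constant, and the constant is 0 because both g and p sum to 0 over {0..<N}.
*)
theory Submission
  imports Defs
begin

section \<open>Entries of \<open>v v\<^sup>*\<close> and of finite sums in the module of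
  matrices\<close>

lemma index_mult_adjoint:
  assumes "i < dim_vec v" and "k < dim_vec v"
  shows "mult_adjoint v $$ (i, k) = v $ i * cnj (v $ k)"
proof -
  have "mult_adjoint v $$ (i, k) =
      mat_of_cols (dim_vec v) [v] $$ (i, 0) * mat_of_rows (dim_vec v) [conjugate v] $$ (0, k)"
    using assms by (simp add: mult_adjoint_def Let_def mat_adjoint_def scalar_prod_def)
  also have "mat_of_cols (dim_vec v) [v] $$ (i, 0) = v $ i"
    using assms by (simp add: mat_of_cols_index)
  also have "mat_of_rows (dim_vec v) [conjugate v] $$ (0, k) = cnj (v $ k)"
    using assms by (subst mat_of_rows_index) simp_all
  finally show ?thesis .
qed

lemma mult_adjoint_carrier: "mult_adjoint v \<in> carrier_mat (dim_vec v) (dim_vec v)"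
  by (rule carrier_matI) (simp_all add: mult_adjoint_def Let_def mat_adjoint_def)

text \<open>This turns the module sum in \<open>K_mat\<close> into ordinary sums of entries.
  Addition in \<open>module_mat\<close> is matrix addition, and the carrier hypothesis keeps every
  partial sum of size \<open>n\<close> by \<open>n'\<close>, so that entries add in the induction
  step.\<close>

lemma index_finsum_mat:
  assumes "finite S" and "f \<in> S \<rightarrow> carrier_mat n n'" and "i < n" and "k < n'"
  shows "finsum (module_mat TYPE('a::comm_ring_1) n n') f S $$ (i, k) = (\<Sum>x\<in>S. f x $$ (i, k))"
  using assms(1,2)
proof (induction S rule: finite_induct)
  case empty
  interpret abelian_group "module_mat TYPE('a) n n'"
    by (rule abelian_group_mat)
  show ?case using assms by (simp add: module_mat_simps)
next
  case (insert x S)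
  interpret abelian_group "module_mat TYPE('a) n n'"
    by (rule abelian_group_mat)
  have "finsum (module_mat TYPE('a) n n') f S \<in> carrier_mat n n'"
    using finsum_closed[of f S] insert.prems by (simp add: module_mat_simps Pi_iff)
  moreover have "finsum (module_mat TYPE('a) n n') f (insert x S) =
      f x + finsum (module_mat TYPE('a) n n') f S"
    using finsum_insert[of S x f] insert by (simp add: module_mat_simps Pi_iff)
  ultimately show ?case
    using insert assms(3,4) by auto
qed

section \<open>Roots of unity and the eigenvalues \<open>mu\<close>\<close>

lemma root_omega_power: "root_omega N ^ j = cis (2 * pi * real j / real N)"
  by (simp add: root_omega_def cis_conv_exp flip: exp_of_nat_mult) (simp add: algebra_simps)

lemma root_omega_power_eq_1_iff:
  assumes "N > 0"
  shows "root_omega N ^ j = 1 \<longleftrightarrow> N dvd j"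
proof
  assume "root_omega N ^ j = 1"
  \<comment> \<open>The real part suffices: a cosine equals 1 only at integer multiples of 2
    pi.\<close>
  then have "cos (2 * pi * real j / real N) = 1"
    by (simp add: root_omega_power complex_eq_iff)
  then obtain n :: int where "2 * pi * real j / real N = of_int n * 2 * pi"
    using cos_one_2pi_int by blast
  then have "real j = of_int n * real N"
    using assms by (simp add: field_simps)
  then have "int j = n * int N"
    by (metis of_int_eq_iff of_int_mult of_int_of_nat_eq)
  then have "int N dvd int j"
    by simp
  then show "N dvd j"
    by simp
next
  assume "N dvd j"
  then obtain k where "j = N * k" ..
  then show "root_omega N ^ j = 1"
    using assms cis_multiple_2pi[of "real k"] by (simp add: root_omega_power mult.assoc)
qed

lemma cnj_root_omega_power: "cnj (root_omega N ^ j) * root_omega N ^ j = 1"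
  by (simp only: root_omega_power cis_cnj cis_mult) simp

text \<open>For w on the unit circle the conjugate is 1/w, so \<open>mu N j\<close> is 2 - w - 1/w;
  multiplying by w completes a square.\<close>

lemma mu_times_root_omega_power:
  "complex_of_real (mu N j) * root_omega N ^ j = - (root_omega N ^ j - 1)\<^sup>2"
proof -
  let ?w = "root_omega N ^ j"
  have "complex_of_real (mu N j) = 2 - (?w + cnj ?w)"
    by (simp only: root_omega_power mu_def complex_add_cnj) simp
  then have "complex_of_real (mu N j) * ?w = 2 * ?w - (?w * ?w + cnj ?w * ?w)"
    by (simp only: ring_distribs)
  also have "\<dots> = - (?w - 1)\<^sup>2"
    by (simp only: cnj_root_omega_power) (simp add: algebra_simps power2_eq_square)
  finally show ?thesis .
qed

lemma mu_neq_0: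
  assumes "j \<in> {1..N - 1}"
  shows "mu N j \<noteq> 0"
proof -
  have "\<not> N dvd j" "N > 0" using assms by (auto dest: dvd_imp_le)
  then show ?thesis
    using mu_times_root_omega_power[of N j] root_omega_power_eq_1_iff[of N j] by auto
qed

text \<open>A geometric sum whose ratio differs from 1 but has \<open>N\<close>-th power 1.\<close>

lemma sum_root_omega_power:
  assumes "N > 0" and "\<not> N dvd e"
  shows "(\<Sum>j<N. root_omega N ^ (j * e)) = 0"
proof -
  have "root_omega N ^ e \<noteq> 1" and "(root_omega N ^ e) ^ N = 1"
    using assms root_omega_power_eq_1_iff[of N] by (auto simp flip: power_mult)
  then have "(\<Sum>j<N. (root_omega N ^ e) ^ j) = 0"
    by (simp add: geometric_sum)
  then show ?thesis by (simp add: mult.commute flip: power_mult)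
qed

section \<open>The kernel sum g (\<open>kernel_sum\<close>) and its closed form p
  (\<open>kernel_poly\<close>)\<close>

definition kernel_sum :: "nat \<Rightarrow> nat \<Rightarrow> complex" where
  "kernel_sum N d = (\<Sum>j = 1..N - 1. root_omega N ^ (j * d) / complex_of_real (mu N j))"

definition kernel_poly :: "nat \<Rightarrow> nat \<Rightarrow> real" where
  "kernel_poly N d = ((real d)\<^sup>2 - real N * real d + ((real N)\<^sup>2 - 1) / 6) / 2"

lemma kernel_sum_second_difference:
  assumes "Suc d < N"
  shows "kernel_sum N (d + 2) - 2 * kernel_sum N (d + 1) + kernel_sum N d = 1"
proof -
  have "\<not> N dvd Suc d" using assms by (auto dest: dvd_imp_le)
  then have "0 = (\<Sum>j<N. root_omega N ^ (j * Suc d))"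
    using assms sum_root_omega_power[of N "Suc d"] by simp
  \<comment> \<open>The split-off term at \<open>j = 0\<close> is 1, which leaves -1 for the
    nontrivial roots.\<close>
  also have "{..<N} = insert 0 {1..N - 1}" using assms by auto
  finally have minus1: "(\<Sum>j = 1..N - 1. root_omega N ^ (j * Suc d)) = - 1"
    by (simp add: eq_neg_iff_add_eq_0 add.commute)
  have "root_omega N ^ (j * (d + 2)) / complex_of_real (mu N j)
      - 2 * (root_omega N ^ (j * (d + 1)) / complex_of_real (mu N j))
      + root_omega N ^ (j * d) / complex_of_real (mu N j) = - (root_omega N ^ (j * Suc d))"
    (is "?second_diff j = _") if "j \<in> {1..N - 1}" for j
  proof -
    let ?w = "root_omega N ^ j"
    have "root_omega N ^ (j * (d + 2)) - 2 * root_omega N ^ (j * (d + 1)) + root_omega N ^ (j * d)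
        = ?w ^ d * (?w - 1)\<^sup>2"
      unfolding power_mult by (simp add: power2_eq_square algebra_simps)
    \<comment> \<open>The square produces exactly the factor \<open>mu N j\<close> that cancels the
      denominator in \<open>kernel_sum\<close>.\<close>
    also have "(?w - 1)\<^sup>2 = - (complex_of_real (mu N j) * ?w)"
      using mu_times_root_omega_power[of N j] by simp
    finally have "root_omega N ^ (j * (d + 2)) - 2 * root_omega N ^ (j * (d + 1)) + root_omega N ^ (j * d)
        = - (complex_of_real (mu N j) * root_omega N ^ (j * Suc d))"
      unfolding power_mult by simp
    then have "(root_omega N ^ (j * (d + 2)) - 2 * root_omega N ^ (j * (d + 1)) + root_omega N ^ (j * d))
        / complex_of_real (mu N j) = - (root_omega N ^ (j * Suc d))"
      using mu_neq_0[OF that] by simp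
    then show ?thesis
      by (simp only: add_divide_distrib diff_divide_distrib times_divide_eq_right)
  qed
  then have "(\<Sum>j = 1..N - 1. ?second_diff j) = (\<Sum>j = 1..N - 1. - (root_omega N ^ (j * Suc d)))"
    by (intro sum.cong) auto
  also have "\<dots> = 1"
    by (simp only: sum_negf minus1 minus_minus)
  finally show ?thesis
    by (simp only: kernel_sum_def sum.distrib sum_subtractf sum_distrib_left)
qed

text \<open>Two-step induction: the recurrence determines \<open>h (d + 2)\<close> from the two
  values before it. Since it holds for all \<open>d\<close> with \<open>d + 2 \<le> N\<close>, the
  endpoint \<open>N\<close> is reached, where periodicity is applied later.\<close>

lemma affine_if_second_difference_0:
  fixes h :: "nat \<Rightarrow> 'a::comm_ring_1"
  assumes "\<And>d. Suc d < N \<Longrightarrow> h (d + 2) - 2 * h (d + 1) + h d = 0" and "d \<le> N"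
  shows "h d = h 0 + of_nat d * (h 1 - h 0)"
  using assms(2)
proof (induction d rule: induct_nat_012)
  case (ge2 d)
  then have "h (d + 2) = 2 * h (d + 1) - h d"
    using assms(1)[of d] by (simp add: algebra_simps)
  then show ?case using ge2 by (simp add: algebra_simps)
qed simp_all

lemma kernel_sum_periodic: "N > 0 \<Longrightarrow> kernel_sum N N = kernel_sum N 0"
  using root_omega_power_eq_1_iff[of N N]
  by (simp add: kernel_sum_def mult.commute[of _ N] power_mult)

text \<open>After exchanging the sums, each inner sum runs over a full period of powers of a
  nontrivial root of unity and vanishes.\<close>

lemma sum_kernel_sum: "(\<Sum>d<N. kernel_sum N d) = 0"
proof -
  have "(\<Sum>d<N. root_omega N ^ (j * d)) = 0" if "j \<in> {1..N - 1}" for j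
  proof -
    have "N > 0" "\<not> N dvd j" using that by (auto dest: dvd_imp_le)
    then show ?thesis using sum_root_omega_power[of N j] by (simp add: mult.commute)
  qed
  then show ?thesis
    unfolding kernel_sum_def by (subst sum.swap) (simp flip: sum_divide_distrib)
qed

lemma sum_kernel_poly: "(\<Sum>d<N. kernel_poly N d) = 0"
proof -
  \<comment> \<open>\<open>N\<close> is both the bound of the sum and a coefficient of the summand;
    separating the two as \<open>n\<close> and \<open>x\<close> makes induction possible. At
    \<open>n = x = N\<close> the closed form vanishes.\<close>
  have "(\<Sum>d<n. ((real d)\<^sup>2 - x * real d + (x\<^sup>2 - 1) / 6) / 2) =
      real n * ((2 * real n - 1) * (real n - 1) - 3 * x * (real n - 1) + x\<^sup>2 - 1) / 12" for n x
    by (induction n) (simp_all add: field_simps power2_eq_square)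
  from this[of "real N" N] show ?thesis
    by (simp add: kernel_poly_def algebra_simps power2_eq_square)
qed

lemma kernel_sum_eq_kernel_poly:
  assumes "d < N"
  shows "kernel_sum N d = complex_of_real (kernel_poly N d)"
proof -
  define h where "h d = kernel_sum N d - complex_of_real (kernel_poly N d)" for d
  have N: "N > 0" using assms by simp
  have "h (d + 2) - 2 * h (d + 1) + h d = 0" if "Suc d < N" for d
  proof -
    have "kernel_poly N (d + 2) - 2 * kernel_poly N (d + 1) + kernel_poly N d = 1"
      by (simp add: kernel_poly_def field_simps power2_eq_square)
    from arg_cong[OF this, of complex_of_real]
    have "complex_of_real (kernel_poly N (d + 2)) - 2 * complex_of_real (kernel_poly N (d + 1))
        + complex_of_real (kernel_poly N d) = 1"
      by simp
    moreover have "h (d + 2) - 2 * h (d + 1) + h d =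
        (kernel_sum N (d + 2) - 2 * kernel_sum N (d + 1) + kernel_sum N d)
        - (complex_of_real (kernel_poly N (d + 2)) - 2 * complex_of_real (kernel_poly N (d + 1))
          + complex_of_real (kernel_poly N d))"
      by (simp add: h_def algebra_simps)
    ultimately show ?thesis
      using kernel_sum_second_difference[OF that] by simp
  qed
  then have affine: "h d = h 0 + of_nat d * (h 1 - h 0)" if "d \<le> N" for d
    using affine_if_second_difference_0[of N h d] that by blast
  \<comment> \<open>\<open>kernel_sum\<close> is periodic, and in \<open>kernel_poly\<close> the
    terms d^2 and N d cancel at \<open>d = N\<close>.\<close>
  have "h N = h 0"
    using kernel_sum_periodic[OF N] by (simp add: h_def kernel_poly_def power2_eq_square)
  then have "of_nat N * (h 1 - h 0) = 0"
    using affine[OF order.refl] by (metis add_cancel_right_right)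
  then have slope: "h 1 - h 0 = 0"
    using N by (metis mult_eq_0_iff of_nat_eq_0_iff less_irrefl)
  have const: "h d = h 0" if "d \<le> N" for d
    using affine[OF that] unfolding slope by (simp only: mult_zero_right add_0_right)
  \<comment> \<open>Both functions have mean zero over a period, which fixes the remaining
    constant.\<close>
  have "0 = (\<Sum>d<N. h d)"
    using sum_kernel_sum[of N] sum_kernel_poly[of N]
    by (simp add: h_def sum_subtractf flip: of_real_sum)
  also have "\<dots> = (\<Sum>d<N. h 0)"
    by (intro sum.cong const) auto
  also have "\<dots> = of_nat N * h 0"
    by simp
  finally have "h 0 = 0" using N by (metis mult_eq_0_iff of_nat_eq_0_iff less_irrefl)
  then have "h d = 0" using const[OF less_imp_le[OF assms]] by (simp only:)
  then show ?thesis by (simp add: h_def)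
qed

section \<open>From the kernel sum to the entries of \<open>K_mat\<close>\<close>

lemma index_K_mat:
  assumes "i < N" and "k < N"
  shows "K_mat N $$ (i, k) = (\<Sum>j = 1..N - 1.
    root_omega N ^ (i * j) * cnj (root_omega N ^ (k * j)) / complex_of_real (mu N j)) / of_nat N"
proof -
  have dim: "dim_vec (fourier_vec N j) = N" for j
    by (simp add: fourier_vec_def)
  \<comment> \<open>Each of the two vector factors contributes a normalisation 1/sqrt N; together
    they give the 1/N.\<close>
  have sqrt: "complex_of_real (sqrt (real N)) * complex_of_real (sqrt (real N)) = of_nat N"
    by (simp flip: of_real_mult)
  have "K_mat N $$ (i, k) = (\<Sum>j = 1..N - 1.
      (complex_of_real (1 / mu N j) \<cdot>\<^sub>m mult_adjoint (fourier_vec N j)) $$ (i, k))"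
    unfolding K_mat_def
    using mult_adjoint_carrier[of "fourier_vec N _", unfolded dim] assms
    by (intro index_finsum_mat) auto
  also have "\<dots> = (\<Sum>j = 1..N - 1.
      root_omega N ^ (i * j) * cnj (root_omega N ^ (k * j)) / complex_of_real (mu N j) / of_nat N)"
  proof (rule sum.cong)
    fix j
    have "(complex_of_real (1 / mu N j) \<cdot>\<^sub>m mult_adjoint (fourier_vec N j)) $$ (i, k) =
        complex_of_real (1 / mu N j) * (fourier_vec N j $ i * cnj (fourier_vec N j $ k))"
      using mult_adjoint_carrier[of "fourier_vec N j", unfolded dim] assms
      by (simp add: index_mult_adjoint dim)
    also have "\<dots> = root_omega N ^ (i * j) * cnj (root_omega N ^ (k * j)) /
        complex_of_real (mu N j) / (complex_of_real (sqrt (real N)) * complex_of_real (sqrt (real N)))"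
      using assms by (simp add: fourier_vec_def)
    finally show "(complex_of_real (1 / mu N j) \<cdot>\<^sub>m mult_adjoint (fourier_vec N j)) $$ (i, k) =
        root_omega N ^ (i * j) * cnj (root_omega N ^ (k * j)) / complex_of_real (mu N j) / of_nat N"
      by (simp only: sqrt)
  qed simp
  finally show ?thesis by (simp add: sum_divide_distrib)
qed

text \<open>Conjugation inverts a root of unity, so only the difference of the indices matters;
  \<open>k \<le> i\<close> makes the natural-number subtraction exact.\<close>

lemma index_K_mat_lower:
  assumes "k \<le> i" and "i < N"
  shows "K_mat N $$ (i, k) = kernel_sum N (i - k) / of_nat N"
proof -
  have "root_omega N ^ (i * j) * cnj (root_omega N ^ (k * j)) = root_omega N ^ (j * (i - k))" for j
  proof -
    have "i * j = j * (i - k) + k * j"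
      using assms by (simp add: algebra_simps diff_mult_distrib2)
    then show ?thesis
      using cnj_root_omega_power[of N "k * j"] by (simp only: power_add) (simp add: mult.assoc mult.commute)
  qed
  then show ?thesis using assms by (simp add: index_K_mat kernel_sum_def)
qed

text \<open>The matrix is Hermitian because each \<open>mu N j\<close> is real; this carries the
  formula from the lower triangle to the upper one.\<close>

lemma cnj_index_K_mat:
  assumes "i < N" and "k < N"
  shows "cnj (K_mat N $$ (i, k)) = K_mat N $$ (k, i)"
  using assms by (simp add: index_K_mat mult.commute)

theorem proposition3p9:
  fixes N l m :: nat
  assumes "N \<ge> 3" and "l \<in> {1..N}" and "m \<in> {1..N}"
  shows "K_mat N $$ (l - 1, m - 1) =
    complex_of_real (1 / (2 * real N) *
      ((real l - real m)\<^sup>2 - real N * \<bar>real l - real m\<bar> + ((real N)\<^sup>2 - 1) / 6))"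
proof -
  have lower: "K_mat N $$ (a - 1, b - 1) = complex_of_real (1 / (2 * real N) *
      ((real a - real b)\<^sup>2 - real N * \<bar>real a - real b\<bar> + ((real N)\<^sup>2 - 1) / 6))"
    if "b \<le> a" "a \<in> {1..N}" "b \<in> {1..N}" for a b
  proof -
    have "K_mat N $$ (a - 1, b - 1) = kernel_sum N (a - b) / of_nat N"
      \<comment> \<open>Both indices are at least 1, so the shift to zero-based indices does not
        change their difference.\<close>
      using index_K_mat_lower[of "b - 1" "a - 1" N] that by (simp add: diff_le_mono)
    also have "\<dots> = complex_of_real (kernel_poly N (a - b) / real N)"
      using kernel_sum_eq_kernel_poly[of "a - b" N] that by simp
    also have "kernel_poly N (a - b) / real N = 1 / (2 * real N) *
      ((real a - real b)\<^sup>2 - real N * \<bar>real a - real b\<bar> + ((real N)\<^sup>2 - 1) / 6)"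
      using that by (simp add: kernel_poly_def of_nat_diff)
    finally show ?thesis .
  qed
  show ?thesis
  proof (cases "m \<le> l")
    case True
    then show ?thesis using lower assms by blast
  next
    case False
    then have "l \<le> m" by simp
    \<comment> \<open>The closed form is real and symmetric in \<open>l\<close> and
      \<open>m\<close>, so conjugating the transposed entry gives the claim.\<close>
    then have "cnj (K_mat N $$ (m - 1, l - 1)) = cnj (complex_of_real (1 / (2 * real N) *
      ((real m - real l)\<^sup>2 - real N * \<bar>real m - real l\<bar> + ((real N)\<^sup>2 - 1) / 6)))"
      using assms by (intro arg_cong[of _ _ cnj] lower) auto
    moreover have "cnj (K_mat N $$ (m - 1, l - 1)) = K_mat N $$ (l - 1, m - 1)"
      using assms by (intro cnj_index_K_mat) auto
    ultimately show ?thesis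
      by (simp only: complex_cnj_complex_of_real power2_commute[of "real m"] abs_minus_commute[of "real m"])
  qed
qed

end
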